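(* Let $\lambda_0,\lambda_1,\varepsilon\in\mathbb{R}$ and $r\in\mathbb{Z}$. If $\lambda_0\varepsilon+\lambda_1r=-\hbar$, then \begin{align*} (W\xi)(x,k)&=\xi(x-\varepsilon,k-r), & (W^{-1}\xi)(x,k)&=\xi(x+\varepsilon,k+r),\\ (R\xi)(x,k)&=e^{\lambda_0x+\lambda_1k}\xi(x,k), & (R^{-1}\xi)(x,k)&=e^{-\lambda_0x-\lambda_1k}\xi(x,k),\\ (U\xi)(x,k)&=(\lambda_0x+\lambda_1k)\xi(x,k) \end{align*} for $\xi\in C^\infty_0(\mathbb{R}\times\mathbb{Z})$ defines a left $\mathcal{C}_\hbar$-module structure on $C^\infty_0(\mathbb{R}\times\mathbb{Z})$. Correspondingly, if $\mu_0,\mu_1,\varepsilon'\in\mathbb{R}$ and $r'\in\mathbb{Z}$ are such that $\mu_0\varepsilon'+\mu_1r'=\hbar$, then \begin{align*} (\xi W)(x,k)&=\xi(x-\varepsilon',k-r'), & (\xi W^{-1})(x,k)&=\xi(x+\varepsilon',k+r'),\\ (\xi R)(x,k)&=e^{\mu_0x+\mu_1k}\xi(x,k), & (\xi R^{-1})(x,k)&=e^{-\mu_0x-\mu_1k}\xi(x,k),\\ (\xi U)(x,k)&=(\mu_0x+\mu_1k)\xi(x,k) \end{align*} defines a right $\mathcal{C}_\hbar$-module structure on $C^\infty_0(\mathbb{R}\times\mathbb{Z})$. Moreover, both the left and the right module structures are compatible with the inner product, i.e. $$\langle a\xi,\eta\rangle=\langle\xi,a^*\eta\rangle\qquad\text{and}\qquad\langle\xi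 a,\eta\rangle=\langle\xi,\eta a^*\rangle$$ for all $a\in\mathcal{C}_\hbar$ and $\xi,\eta\in C^\infty_0(\mathbb{R}\times\mathbb{Z})$.
   Context: Let $\hbar\in\mathbb{R}$. $\mathcal{C}_\hbar$ is the unital associative $\mathbb{C}$-algebra with generators $U,R,R^{-1},W,W^{-1}$ and relations $WW^{-1}=W^{-1}W=1$, $RR^{-1}=R^{-1}R=1$, $RU=UR$, $R^{-1}U=UR^{-1}$, $WR=e^{\hbar}RW$, $WR^{-1}=e^{-\hbar}R^{-1}W$, $W^{-1}R=e^{-\hbar}RW^{-1}$, $W^{-1}R^{-1}=e^{\hbar}R^{-1}W^{-1}$, $WU=UW+\hbar W$, $W^{-1}U=UW^{-1}-\hbar W^{-1}$. It is a $*$-algebra via $U^*=U$, $R^*=R$, $(R^{-1})^*=R^{-1}$, $W^*=W^{-1}$, $(W^{-1})^*=W$. $C^\infty_0(\mathbb{R}\times\mathbb{Z})$ is the space of complex-valued smooth functions on $\mathbb{R}\times\mathbb{Z}$ with compact support (in both variables), with inner product $\langle\xi,\eta\rangle=\sum_{k=-\infty}^\infty\int_{-\infty}^\infty\xi(x,k)\overline{\eta(x,k)}\,dx$. *)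

theory Defs
  imports
    "HOL-Analysis.Analysis"
    "HOL-Library.Poly_Mapping"
    "HOL-Algebra.QuotRing"
    "HOL-Algebra.Algebraic_Closure_Type"
begin

section \<open>The free unital complex algebra on the five generators\<close>

datatype gen = gen_U | gen_R | gen_Rinv | gen_W | gen_Winv

text \<open>
  Concatenation of words is written additively, since \<^typ>\<open>'a \<Rightarrow>\<^sub>0 'b\<close> has an additive exponent monoid; its
  convolution product is then the product of the free algebra.
\<close>

datatype gword = GWord (letters: "gen list")

instantiation gword :: monoid_add
begin

definition zero_gword :: gword where "0 = GWord []"

definition plus_gword :: "gword \<Rightarrow> gword \<Rightarrow> gword" where
  "v + w = GWord (letters v @ letters w)"

instance
  by standard (simp_all add: zero_gword_def plus_gword_def)

end

type_synonym free_alg = "gword \<Rightarrow>\<^sub>0 complex"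

abbreviation free_ring :: "free_alg ring" where
  "free_ring \<equiv> ring_of_type_algebra"

definition fvar :: "gen \<Rightarrow> free_alg" where
  "fvar g = Poly_Mapping.single (GWord [g]) 1"

definition scal :: "complex \<Rightarrow> free_alg" where
  "scal c = Poly_Mapping.single 0 c"

fun gen_star :: "gen \<Rightarrow> gen" where
  "gen_star gen_U = gen_U"
| "gen_star gen_R = gen_R"
| "gen_star gen_Rinv = gen_Rinv"
| "gen_star gen_W = gen_Winv"
| "gen_star gen_Winv = gen_W"

definition gword_star :: "gword \<Rightarrow> gword" where
  "gword_star w = GWord (rev (map gen_star (letters w)))"

text \<open>The conjugate-linear anti-automorphism of the free algebra extending \<open>gen_star\<close>.\<close>

definition free_star :: "free_alg \<Rightarrow> free_alg" where
  "free_star f =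
     (\<Sum>w\<in>Poly_Mapping.keys f. Poly_Mapping.single (gword_star w) (cnj (Poly_Mapping.lookup f w)))"


section \<open>The *-algebra \<open>C\<^sub>\<hbar>\<close>\<close>

definition C_rels :: "real \<Rightarrow> free_alg set" where
  "C_rels hbar =
    (let U = fvar gen_U; R = fvar gen_R; R' = fvar gen_Rinv; W = fvar gen_W; W' = fvar gen_Winv;
         h = scal (of_real hbar); q = scal (of_real (exp hbar)); q' = scal (of_real (exp (- hbar)))
     in {W * W' - 1, W' * W - 1, R * R' - 1, R' * R - 1,
         R * U - U * R, R' * U - U * R',
         W * R - q * (R * W), W * R' - q' * (R' * W),
         W' * R - q' * (R * W'), W' * R' - q * (R' * W'),
         W * U - (U * W + h * W), W' * U - (U * W' - h * W')})"

definition C_ideal :: "real \<Rightarrow> free_alg set" where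
  "C_ideal hbar = Idl\<^bsub>free_ring\<^esub> (C_rels hbar)"

definition C_alg :: "real \<Rightarrow> free_alg set ring" where
  "C_alg hbar = free_ring Quot (C_ideal hbar)"

definition C_class :: "real \<Rightarrow> free_alg \<Rightarrow> free_alg set" where
  "C_class hbar f = C_ideal hbar +>\<^bsub>free_ring\<^esub> f"

abbreviation C_gen :: "real \<Rightarrow> gen \<Rightarrow> free_alg set" where
  "C_gen hbar g \<equiv> C_class hbar (fvar g)"

abbreviation C_scal :: "real \<Rightarrow> complex \<Rightarrow> free_alg set" where
  "C_scal hbar c \<equiv> C_class hbar (scal c)"

text \<open>
  Elements of \<open>C_alg hbar\<close> are cosets. Since \<open>free_star\<close> is an additive involution that maps the
  ideal onto itself, the image of the coset of \<open>f\<close> is the coset of \<open>free_star f\<close>; no choice of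
  representative (and no reference to \<open>hbar\<close>) is needed.
\<close>

definition C_star :: "free_alg set \<Rightarrow> free_alg set" where
  "C_star a = free_star ` a"


section \<open>Modules over a noncommutative ring\<close>

text \<open>The locale \<^locale>\<open>module\<close> requires a commutative ring of scalars.\<close>

locale left_module = R?: ring R + M?: abelian_group M
  for R (structure) and M (structure) +
  fixes lact :: "'a \<Rightarrow> 'c \<Rightarrow> 'c" (infixr \<open>\<rhd>\<close> 70)
  assumes lact_closed: "\<lbrakk>a \<in> carrier R; x \<in> carrier M\<rbrakk> \<Longrightarrow> a \<rhd> x \<in> carrier M"
    and lact_add_left: "\<lbrakk>a \<in> carrier R; b \<in> carrier R; x \<in> carrier M\<rbrakk>
          \<Longrightarrow> (a \<oplus> b) \<rhd> x = (a \<rhd> x) \<oplus>\<^bsub>M\<^esub> (b \<rhd> x)"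
    and lact_add_right: "\<lbrakk>a \<in> carrier R; x \<in> carrier M; y \<in> carrier M\<rbrakk>
          \<Longrightarrow> a \<rhd> (x \<oplus>\<^bsub>M\<^esub> y) = (a \<rhd> x) \<oplus>\<^bsub>M\<^esub> (a \<rhd> y)"
    and lact_assoc: "\<lbrakk>a \<in> carrier R; b \<in> carrier R; x \<in> carrier M\<rbrakk>
          \<Longrightarrow> (a \<otimes> b) \<rhd> x = a \<rhd> (b \<rhd> x)"
    and lact_one: "x \<in> carrier M \<Longrightarrow> \<one> \<rhd> x = x"

locale right_module = R?: ring R + M?: abelian_group M
  for R (structure) and M (structure) +
  fixes ract :: "'c \<Rightarrow> 'a \<Rightarrow> 'c" (infixl \<open>\<lhd>\<lhd>\<close> 70)
  assumes ract_closed: "\<lbrakk>x \<in> carrier M; a \<in> carrier R\<rbrakk> \<Longrightarrow> x \<lhd>\<lhd> a \<in> carrier M"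
    and ract_add_right: "\<lbrakk>x \<in> carrier M; a \<in> carrier R; b \<in> carrier R\<rbrakk>
          \<Longrightarrow> x \<lhd>\<lhd> (a \<oplus> b) = (x \<lhd>\<lhd> a) \<oplus>\<^bsub>M\<^esub> (x \<lhd>\<lhd> b)"
    and ract_add_left: "\<lbrakk>x \<in> carrier M; y \<in> carrier M; a \<in> carrier R\<rbrakk>
          \<Longrightarrow> (x \<oplus>\<^bsub>M\<^esub> y) \<lhd>\<lhd> a = (x \<lhd>\<lhd> a) \<oplus>\<^bsub>M\<^esub> (y \<lhd>\<lhd> a)"
    and ract_assoc: "\<lbrakk>x \<in> carrier M; a \<in> carrier R; b \<in> carrier R\<rbrakk>
          \<Longrightarrow> x \<lhd>\<lhd> (a \<otimes> b) = (x \<lhd>\<lhd> a) \<lhd>\<lhd> b"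
    and ract_one: "x \<in> carrier M \<Longrightarrow> x \<lhd>\<lhd> \<one> = x"


section \<open>Smooth compactly supported functions on \<open>\<real> \<times> \<int>\<close>\<close>

definition smooth :: "(real \<Rightarrow> complex) \<Rightarrow> bool" where
  "smooth f \<longleftrightarrow> (\<exists>D. D 0 = f \<and> (\<forall>n x. (D n has_vector_derivative D (Suc n) x) (at x)))"

text \<open>\<^typ>\<open>int\<close> carries the discrete topology, so the closure and compactness are those of \<open>\<real> \<times> \<int>\<close>.\<close>

definition C0inf :: "(real \<times> int \<Rightarrow> complex) set" where
  "C0inf = {\<xi>. (\<forall>k. smooth (\<lambda>x. \<xi> (x, k))) \<and> compact (closure {p. \<xi> p \<noteq> 0})}"

text \<open>
  Only the additive group is used; \<^const>\<open>abelian_group\<close> expects a record that also has slots for a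
  multiplication and a unit.
\<close>

definition C0inf_group :: "(real \<times> int \<Rightarrow> complex) ring" where
  "C0inf_group = \<lparr>carrier = C0inf, monoid.mult = undefined, one = undefined,
     ring.zero = (\<lambda>p. 0), add = (\<lambda>\<xi> \<eta> p. \<xi> p + \<eta> p)\<rparr>"

definition C0inf_inner :: "(real \<times> int \<Rightarrow> complex) \<Rightarrow> (real \<times> int \<Rightarrow> complex) \<Rightarrow> complex" where
  "C0inf_inner \<xi> \<eta> = (\<Sum>\<^sub>\<infinity>k\<in>UNIV. LINT x|lborel. \<xi> (x, k) * cnj (\<eta> (x, k)))"

text \<open>
  Module structures over the complex algebra \<open>C_alg hbar\<close>: the scalar multiples of the unit act by
  the given scalar multiplication of functions.
\<close>

definition C_left_module ::
  "real \<Rightarrow> (free_alg set \<Rightarrow> (real \<times> int \<Rightarrow> complex) \<Rightarrow> (real \<times> int \<Rightarrow> complex)) \<Rightarrow> bool" where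
  "C_left_module hbar lact \<longleftrightarrow>
     left_module (C_alg hbar) C0inf_group lact \<and>
     (\<forall>c. \<forall>\<xi>\<in>C0inf. lact (C_scal hbar c) \<xi> = (\<lambda>p. c * \<xi> p))"

definition C_right_module ::
  "real \<Rightarrow> ((real \<times> int \<Rightarrow> complex) \<Rightarrow> free_alg set \<Rightarrow> (real \<times> int \<Rightarrow> complex)) \<Rightarrow> bool" where
  "C_right_module hbar ract \<longleftrightarrow>
     right_module (C_alg hbar) C0inf_group ract \<and>
     (\<forall>c. \<forall>\<xi>\<in>C0inf. ract \<xi> (C_scal hbar c) = (\<lambda>p. c * \<xi> p))"

end

theory Submission
  imports Defs
begin

text \<open>
  Send each generator to the stated operator on all functions \<open>\<real> \<times> \<int> \<rightarrow> \<complex>\<close>. This extends to a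
  homomorphism (left case) or an antihomomorphism (right case) from the free algebra to the linear
  operators. By \<open>\<lambda>\<^sub>0 \<epsilon> + \<lambda>\<^sub>1 r = \<mp>\<hbar>\<close> its kernel contains the defining relations, hence the ideal they
  generate, so it induces an action of the cosets. Each generator maps \<open>C\<^sub>0\<^sup>\<infinity>\<close> to itself and is adjoint
  to its star: a translation by translation invariance of the Lebesgue and counting measures, and the
  other generators because they multiply by real functions. Both properties pass to sums and products.
\<close>

section \<open>Smooth functions with compact support\<close>

text \<open>Choosing for every member of \<open>S\<close> a derivative in \<open>S\<close> gives an
  operator on \<open>S\<close>, whose iterates at \<open>f\<close> form the sequence that
  \<open>smooth\<close> asks for.\<close>

lemma smooth_coinduct:
  assumes "f \<in> S"
    and "\<And>f. f \<in> S \<Longrightarrow> \<exists>f'\<in>S. \<forall>x. (f has_vector_derivative f' x) (at x)"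
  shows "smooth f"
proof -
  obtain d where d: "\<And>f. f \<in> S \<Longrightarrow> d f \<in> S"
    "\<And>f x. f \<in> S \<Longrightarrow> (f has_vector_derivative d f x) (at x)"
    using assms(2) by metis
  have "(d ^^ n) f \<in> S" for n
    by (induction n) (use assms(1) d in auto)
  then show ?thesis
    unfolding smooth_def by (intro exI[of _ "\<lambda>n. (d ^^ n) f"]) (auto intro: d)
qed

lemma smooth_deriv:
  assumes "smooth f"
  obtains f' where "smooth f'" "\<And>x. (f has_vector_derivative f' x) (at x)"
proof -
  obtain D where D: "D 0 = f" "\<And>n x. (D n has_vector_derivative D (Suc n) x) (at x)"
    using assms unfolding smooth_def by blast
  have "smooth (D 1)"
    unfolding smooth_def by (rule exI[of _ "\<lambda>n. D (Suc n)"]) (use D in auto)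
  moreover have "(f has_vector_derivative D 1 x) (at x)" for x
    using D(2)[of 0] D(1) by simp
  ultimately show thesis by (rule that)
qed

lemma smooth_imp_continuous_on: "smooth f \<Longrightarrow> continuous_on S f"
  by (metis smooth_deriv continuous_at_imp_continuous_on has_vector_derivative_continuous)

text \<open>The sums of products of smooth functions contain a derivative of each of their members, so that
  coinduction gives smoothness of products without the Leibniz formula for higher derivatives.\<close>

inductive_set smooth_alg :: "(real \<Rightarrow> complex) set" where
  mult: "smooth f \<Longrightarrow> smooth g \<Longrightarrow> (\<lambda>x. f x * g x) \<in> smooth_alg"
| add: "f \<in> smooth_alg \<Longrightarrow> g \<in> smooth_alg \<Longrightarrow> (\<lambda>x. f x + g x) \<in> smooth_alg"

lemma smooth_alg_smooth: "f \<in> smooth_alg \<Longrightarrow> smooth f"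
proof (erule smooth_coinduct)
  fix f assume "f \<in> smooth_alg"
  then show "\<exists>f'\<in>smooth_alg. \<forall>x. (f has_vector_derivative f' x) (at x)"
  proof induction
    case (mult f g)
    obtain f' where "smooth f'" "\<And>x. (f has_vector_derivative f' x) (at x)"
      using mult(1) by (rule smooth_deriv) blast
    moreover obtain g' where "smooth g'" "\<And>x. (g has_vector_derivative g' x) (at x)"
      using mult(2) by (rule smooth_deriv) blast
    ultimately show ?case
      using mult by (intro bexI[of _ "\<lambda>x. f x * g' x + f' x * g x"])
        (auto intro: smooth_alg.intros has_vector_derivative_mult)
  next
    case (add f g)
    then obtain f' g' where "f' \<in> smooth_alg" "\<forall>x. (f has_vector_derivative f' x) (at x)"
      "g' \<in> smooth_alg" "\<forall>x. (g has_vector_derivative g' x) (at x)"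
      by blast
    then show ?case
      by (intro bexI[of _ "\<lambda>x. f' x + g' x"])
        (auto intro: smooth_alg.intros has_vector_derivative_add)
  qed
qed

lemma smooth_mult: "smooth f \<Longrightarrow> smooth g \<Longrightarrow> smooth (\<lambda>x. f x * g x)"
  by (rule smooth_alg_smooth) (rule smooth_alg.mult)

lemma smooth_affine: "smooth (\<lambda>x. of_real (a * x + b))"
proof (rule smooth_coinduct[where S = "{\<lambda>x. of_real (a * x + b) | a b. True}"])
  fix f :: "real \<Rightarrow> complex" assume "f \<in> {\<lambda>x. of_real (a * x + b) | a b. True}"
  then obtain a b where f: "f = (\<lambda>x. of_real (a * x + b))" by blast
  \<comment> \<open>The constant derivative is written as an affine function to show that it stays
    in the coinduction set.\<close>
  have "\<forall>x. (f has_vector_derivative of_real (0 * x + a)) (at x)"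
    unfolding f by (auto intro!: derivative_eq_intros)
  then show "\<exists>f'\<in>{\<lambda>x. of_real (a * x + b) | a b. True}. \<forall>x. (f has_vector_derivative f' x) (at x)"
    by (intro bexI[of _ "\<lambda>x. of_real (0 * x + a)"] CollectI exI[of _ 0] exI[of _ a]) auto
qed blast

lemma smooth_const: "smooth (\<lambda>x. c)"
  by (rule smooth_coinduct[where S = "range (\<lambda>c x. c)"])
    (auto intro!: derivative_eq_intros rev_image_eqI[of 0])

lemma smooth_exp: "smooth (\<lambda>x. of_real (exp (a * x + b)))"
  unfolding smooth_def
  by (rule exI[of _ "\<lambda>n x. of_real (a ^ n * exp (a * x + b))"])
    (auto intro!: derivative_eq_intros simp: mult_ac)

text \<open>Since \<open>smooth_alg\<close> starts from products, each summand enters it as a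
  product with the constant 1.\<close>

lemma smooth_add: "smooth f \<Longrightarrow> smooth g \<Longrightarrow> smooth (\<lambda>x. f x + g x)"
  using smooth_alg_smooth[OF smooth_alg.add[OF smooth_alg.mult[OF _ smooth_const[of 1]]
        smooth_alg.mult[OF _ smooth_const[of 1]]], of f g] by simp

lemma smooth_shift:
  assumes "smooth f" shows "smooth (\<lambda>x. f (x + a))"
proof (rule smooth_coinduct[where S = "{\<lambda>x. f (x + a) | f. smooth f}"])
  fix g assume "g \<in> {\<lambda>x. f (x + a) | f. smooth f}"
  then obtain f where f: "g = (\<lambda>x. f (x + a))" "smooth f" by blast
  obtain f' where f': "smooth f'" "\<And>x. (f has_vector_derivative f' x) (at x)"
    using f(2) by (rule smooth_deriv) blast
  have "(g has_vector_derivative f' (x + a)) (at x)" for x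
    using f'(2)[of "x + a"] unfolding f(1) has_vector_derivative_def
    by (rule has_derivative_compose[rotated, where f = "\<lambda>x. x + a", unfolded o_def, simplified])
      (auto intro!: derivative_eq_intros)
  then show "\<exists>g'\<in>{\<lambda>x. f (x + a) |f. smooth f}. \<forall>x. (g has_vector_derivative g' x) (at x)"
    using f'(1) by (intro bexI[of _ "\<lambda>x. f' (x + a)"]) auto
qed (use assms in blast)

section \<open>Membership in \<open>C0inf\<close> and its closure properties\<close>

text \<open>Supports need not be computed: the closure of the nonzero set is a closed subset of any
  compact \<open>K\<close> that contains this set.\<close>

lemma C0infI:
  assumes "\<And>k. smooth (\<lambda>x. \<xi> (x, k))" "{p. \<xi> p \<noteq> 0} \<subseteq> K" "compact K"
  shows "\<xi> \<in> C0inf"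
proof -
  have "closure {p. \<xi> p \<noteq> 0} \<subseteq> K"
    using assms by (intro closure_minimal compact_imp_closed)
  then have "compact (closure {p. \<xi> p \<noteq> 0})"
    using compact_Int_closed[OF assms(3) closed_closure, of "{p. \<xi> p \<noteq> 0}"]
    by (simp add: Int_absorb1)
  with assms(1) show ?thesis by (simp add: C0inf_def)
qed

lemma C0infD:
  assumes "\<xi> \<in> C0inf"
  shows "smooth (\<lambda>x. \<xi> (x, k))" "compact (closure {p. \<xi> p \<noteq> 0})"
  using assms by (auto simp: C0inf_def)

lemma C0inf_add:
  assumes "\<xi> \<in> C0inf" "\<eta> \<in> C0inf"
  shows "(\<lambda>p. \<xi> p + \<eta> p) \<in> C0inf"
proof (rule C0infI[where K = "closure {p. \<xi> p \<noteq> 0} \<union> closure {p. \<eta> p \<noteq> 0}"])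
  show "{p. \<xi> p + \<eta> p \<noteq> 0} \<subseteq> closure {p. \<xi> p \<noteq> 0} \<union> closure {p. \<eta> p \<noteq> 0}"
    using closure_subset[of "{p. \<xi> p \<noteq> 0}"] closure_subset[of "{p. \<eta> p \<noteq> 0}"] by fastforce
qed (use assms in \<open>auto intro: smooth_add compact_Un C0infD\<close>)

lemma C0inf_mult:
  assumes "\<xi> \<in> C0inf" "\<And>k. smooth (\<lambda>x. m (x, k))"
  shows "(\<lambda>p. m p * \<xi> p) \<in> C0inf"
proof (rule C0infI[where K = "closure {p. \<xi> p \<noteq> 0}"])
  show "{p. m p * \<xi> p \<noteq> 0} \<subseteq> closure {p. \<xi> p \<noteq> 0}"
    using closure_subset[of "{p. \<xi> p \<noteq> 0}"] by fastforce
qed (use assms in \<open>auto intro: smooth_mult C0infD\<close>)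

lemma C0inf_cmult: "\<xi> \<in> C0inf \<Longrightarrow> (\<lambda>p. c * \<xi> p) \<in> C0inf"
  by (rule C0inf_mult) (auto intro: smooth_const)

lemma C0inf_zero: "(\<lambda>p. 0) \<in> C0inf"
  by (rule C0infI[where K = "{}"]) (auto intro: smooth_const)

lemma C0inf_shift:
  assumes "\<xi> \<in> C0inf"
  shows "(\<lambda>p. \<xi> (fst p + a, snd p + b)) \<in> C0inf"
proof (rule C0infI)
  let ?K = "closure {p. \<xi> p \<noteq> 0}"
  \<comment> \<open>The inverse translation carries the support of \<xi> onto a compact set
    containing the nonzero points of the translate.\<close>
  let ?T = "\<lambda>p. (fst p - a, snd p - b)"
  show "smooth (\<lambda>x. \<xi> (fst (x, k) + a, snd (x, k) + b))" for k
    using smooth_shift[OF C0infD(1)[OF assms]] by simp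
  have *: "continuous_on UNIV (\<lambda>k::int. k - b)"
    by (auto simp: continuous_on_open_vimage open_discrete)
  show "compact (?T ` ?K)"
    using assms by (intro compact_continuous_image C0infD continuous_intros
      continuous_on_compose2[OF *]) auto
  show "{p. \<xi> (fst p + a, snd p + b) \<noteq> 0} \<subseteq> ?T ` ?K"
  proof
    fix p assume "p \<in> {p. \<xi> (fst p + a, snd p + b) \<noteq> 0}"
    then have "(fst p + a, snd p + b) \<in> ?K"
      by (intro subsetD[OF closure_subset]) auto
    then show "p \<in> ?T ` ?K" by (intro rev_image_eqI) auto
  qed
qed

lemma abelian_group_C0inf: "abelian_group C0inf_group"
proof (rule abelian_groupI)
  fix \<xi> assume "\<xi> \<in> carrier C0inf_group"
  then show "\<exists>\<eta>\<in>carrier C0inf_group. \<eta> \<oplus>\<^bsub>C0inf_group\<^esub> \<xi> = \<zero>\<^bsub>C0inf_group\<^esub>"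
    using C0inf_cmult[of \<xi> "-1"]
    by (intro bexI[of _ "\<lambda>p. - 1 * \<xi> p"]) (auto simp: C0inf_group_def)
qed (auto simp: C0inf_group_def C0inf_add C0inf_zero add_ac)

section \<open>The inner product and adjoints with respect to it\<close>

text \<open>The projection of the support to the integers is compact in a discrete space, hence
  covered by finitely many singletons. So the sum in the inner product has only finitely many
  nonzero terms.\<close>

lemma finite_rows:
  assumes "\<xi> \<in> C0inf" shows "finite {k. \<exists>x. \<xi> (x, k) \<noteq> 0}"
proof -
  let ?K = "closure {p. \<xi> p \<noteq> 0}"
  have "compact (snd ` ?K)"
    by (intro compact_continuous_image C0infD assms continuous_intros)
  then obtain C where C: "C \<subseteq> range (\<lambda>k::int. {k})" "finite C" "snd ` ?K \<subseteq> \<Union>C"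
    by (rule compactE[of _ "range (\<lambda>k. {k})"]) (auto simp: open_discrete)
  then have "finite (\<Union>C)" by auto
  moreover have "{k. \<exists>x. \<xi> (x, k) \<noteq> 0} \<subseteq> snd ` ?K"
    using closure_subset[of "{p. \<xi> p \<noteq> 0}"] by force
  ultimately show ?thesis using C(3) by (meson finite_subset subset_trans)
qed

text \<open>The integrand is continuous and vanishes outside the compact projection of the support
  of \<xi>.\<close>

lemma integrable_C0inf_inner:
  assumes "\<xi> \<in> C0inf" "\<eta> \<in> C0inf"
  shows "integrable lborel (\<lambda>x. \<xi> (x, k) * cnj (\<eta> (x, k)))"
proof -
  let ?K = "fst ` closure {p. \<xi> p \<noteq> 0}"
  let ?f = "\<lambda>x. \<xi> (x, k) * cnj (\<eta> (x, k))"
  have "integrable lborel (\<lambda>x. indicator ?K x *\<^sub>R ?f x)"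
    using assms by (intro borel_integrable_compact compact_continuous_image continuous_intros
      smooth_imp_continuous_on C0infD)
  moreover have "indicator ?K x *\<^sub>R ?f x = ?f x" for x
    using closure_subset[of "{p. \<xi> p \<noteq> 0}"] by (force simp: indicator_def image_iff)
  ultimately show ?thesis by simp
qed

lemma summable_C0inf_inner:
  assumes "\<xi> \<in> C0inf"
  shows "(\<lambda>k. LINT x|lborel. \<xi> (x, k) * cnj (\<eta> (x, k))) summable_on UNIV"
proof (rule finite_nonzero_values_imp_summable_on, rule finite_subset[OF _ finite_rows[OF assms]])
  have "(LINT x|lborel. \<xi> (x, k) * cnj (\<eta> (x, k))) = 0" if "\<forall>x. \<xi> (x, k) = 0" for k
    using that by simp
  then show "{k \<in> UNIV. (LINT x|lborel. \<xi> (x, k) * cnj (\<eta> (x, k))) \<noteq> 0} \<subseteq> {k. \<exists>x. \<xi> (x, k) \<noteq> 0}"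
    by blast
qed

lemma C0inf_inner_add_left:
  assumes "\<xi> \<in> C0inf" "\<xi>' \<in> C0inf" "\<eta> \<in> C0inf"
  shows "C0inf_inner (\<lambda>p. \<xi> p + \<xi>' p) \<eta> = C0inf_inner \<xi> \<eta> + C0inf_inner \<xi>' \<eta>"
  unfolding C0inf_inner_def using assms
  by (simp add: ring_distribs integrable_C0inf_inner summable_C0inf_inner infsum_add)

lemma C0inf_inner_add_right:
  assumes "\<xi> \<in> C0inf" "\<eta> \<in> C0inf" "\<eta>' \<in> C0inf"
  shows "C0inf_inner \<xi> (\<lambda>p. \<eta> p + \<eta>' p) = C0inf_inner \<xi> \<eta> + C0inf_inner \<xi> \<eta>'"
  unfolding C0inf_inner_def using assms
  by (simp add: ring_distribs integrable_C0inf_inner summable_C0inf_inner infsum_add)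

text \<open>Applied with real \<open>m\<close> to the multiplication operators and with constant
  \<open>m\<close> to the scalars.\<close>

lemma C0inf_inner_mult:
  assumes "\<And>p. m' p = cnj (m p)"
  shows "C0inf_inner (\<lambda>p. m p * \<xi> p) \<eta> = C0inf_inner \<xi> (\<lambda>p. m' p * \<eta> p)"
  unfolding C0inf_inner_def assms by (simp add: mult_ac)

lemma C0inf_inner_shift:
  "C0inf_inner (\<lambda>p. \<xi> (fst p + a, snd p + b)) \<eta> = C0inf_inner \<xi> (\<lambda>p. \<eta> (fst p - a, snd p - b))"
proof -
  let ?g = "\<lambda>k. LINT x|lborel. \<xi> (x, k) * cnj (\<eta> (x - a, k - b))"
  have "(LINT x|lborel. \<xi> (x + a, k + b) * cnj (\<eta> (x, k))) = ?g (k + b)" for k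
    \<comment> \<open>The pattern for \<open>f\<close> selects the integral on the right, where
      \<open>a + x\<close> is substituted for \<open>x\<close>.\<close>
    by (subst lborel_integral_real_affine[where t = a and c = 1 and f = "\<lambda>x. \<xi> (x, k + b) * _ x"])
      (simp_all add: add_ac)
  then have "C0inf_inner (\<lambda>p. \<xi> (fst p + a, snd p + b)) \<eta> = (\<Sum>\<^sub>\<infinity>k\<in>UNIV. ?g (k + b))"
    by (simp add: C0inf_inner_def)
  also have "\<dots> = (\<Sum>\<^sub>\<infinity>k\<in>UNIV. ?g k)"
    by (rule infsum_reindex_bij_betw, rule bij_betw_byWitness[where f' = "\<lambda>k. k - b"]) auto
  finally show ?thesis by (simp add: C0inf_inner_def)
qed

section \<open>Actions of the free algebra\<close>

text \<open>Every element is a sum of monomials; zero is the monomial with coefficient 0. This suits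
  identities additive in each factor, which it reduces to monomials.\<close>

lemma free_alg_add_induct [case_names single add]:
  fixes f :: free_alg
  assumes single: "\<And>w c. P (Poly_Mapping.single w c)"
    and add: "\<And>f g. P f \<Longrightarrow> P g \<Longrightarrow> P (f + g)"
  shows "P f"
proof (induction f rule: Poly_Mapping.update_induct)
  case const
  show ?case using single[of 0 0] by simp
next
  case (update f w c)
  then have "Poly_Mapping.update w c f = Poly_Mapping.single w c + f"
    by (intro poly_mapping_eqI)
      (auto simp: lookup_update lookup_add lookup_single in_keys_iff when_def)
  with update single add show ?case by metis
qed

text \<open>Scalars and generators generate the free algebra, since a monomial is the product of its
  letters and its coefficient. This suits properties that pass to products.\<close>

lemma free_alg_induct [case_names scal var add mult]:
  assumes scal: "\<And>c. P (scal c)" and var: "\<And>g. P (fvar g)"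
    and add: "\<And>f g. P f \<Longrightarrow> P g \<Longrightarrow> P (f + g)"
    and mult: "\<And>f g. P f \<Longrightarrow> P g \<Longrightarrow> P (f * g)"
  shows "P f"
proof (induction f rule: free_alg_add_induct)
  case (single w c)
  have "P (Poly_Mapping.single (GWord gs) c)" for gs
  proof (induction gs)
    case Nil
    show ?case using scal[of c] by (simp add: scal_def zero_gword_def)
  next
    case (Cons g gs)
    have "Poly_Mapping.single (GWord (g # gs)) c = fvar g * Poly_Mapping.single (GWord gs) c"
      by (simp add: fvar_def mult_single plus_gword_def)
    with Cons mult var show ?case by metis
  qed
  then show ?case by (cases w) simp
qed (rule add)

lemma free_star_single [simp]:
  "free_star (Poly_Mapping.single w c) = Poly_Mapping.single (gword_star w) (cnj c)"
  by (cases "c = 0") (simp_all add: free_star_def)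

lemma free_star_add: "free_star (f + g) = free_star f + free_star g"
  unfolding free_star_def by (rule setsum_keys_plus_distrib) (simp_all add: single_add)

lemma free_star_mult: "free_star (f * g) = free_star g * free_star f"
proof (induction f rule: free_alg_add_induct)
  case (single v c)
  show ?case
    by (induction g rule: free_alg_add_induct)
      (simp_all add: mult_single gword_star_def plus_gword_def free_star_add ring_distribs mult.commute)
qed (simp add: free_star_add ring_distribs)

section \<open>Linear extension of operators from words to the free algebra\<close>

definition act :: "(gword \<Rightarrow> ('x \<Rightarrow> complex) \<Rightarrow> 'x \<Rightarrow> complex) \<Rightarrow> free_alg \<Rightarrow> ('x \<Rightarrow> complex) \<Rightarrow> 'x \<Rightarrow> complex"
  where "act F f \<xi> p = (\<Sum>w\<in>Poly_Mapping.keys f. Poly_Mapping.lookup f w * F w \<xi> p)"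

lemma act_single: "act F (Poly_Mapping.single w c) \<xi> = (\<lambda>p. c * F w \<xi> p)"
  by (cases "c = 0") (simp_all add: act_def fun_eq_iff)

lemma act_add: "act F (f + g) \<xi> = (\<lambda>p. act F f \<xi> p + act F g \<xi> p)"
proof
  show "act F (f + g) \<xi> p = act F f \<xi> p + act F g \<xi> p" for p
    unfolding act_def
    by (rule setsum_keys_plus_distrib[where f = "\<lambda>w c. c * F w \<xi> p"]) (simp_all add: ring_distribs)
qed

definition linear_op :: "(('x \<Rightarrow> complex) \<Rightarrow> 'x \<Rightarrow> complex) \<Rightarrow> bool" where
  "linear_op T \<longleftrightarrow>
    (\<forall>\<xi> \<eta>. T (\<lambda>p. \<xi> p + \<eta> p) = (\<lambda>p. T \<xi> p + T \<eta> p)) \<and> (\<forall>c \<xi>. T (\<lambda>p. c * \<xi> p) = (\<lambda>p. c * T \<xi> p))"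

lemma linear_op_add: "linear_op T \<Longrightarrow> T (\<lambda>p. \<xi> p + \<eta> p) = (\<lambda>p. T \<xi> p + T \<eta> p)"
  and linear_op_cmult: "linear_op T \<Longrightarrow> T (\<lambda>p. c * \<xi> p) = (\<lambda>p. c * T \<xi> p)"
  by (simp_all add: linear_op_def)

lemma linear_op_zero: "linear_op T \<Longrightarrow> T (\<lambda>p. 0) = (\<lambda>p. 0)"
  using linear_op_cmult[of T 0] by simp

lemma linear_op_act: "(\<And>w. linear_op (F w)) \<Longrightarrow> linear_op (act F f)"
  unfolding linear_op_def act_def
  by (simp add: ring_distribs sum.distrib sum_distrib_left mult.left_commute)

lemma linear_op_foldr: "(\<And>g. linear_op (op g)) \<Longrightarrow> linear_op (foldr op gs)"
  by (induction gs) (auto simp: linear_op_def)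

lemma linear_op_fold: "(\<And>g. linear_op (op g)) \<Longrightarrow> linear_op (fold op gs)"
  by (induction gs) (auto simp: linear_op_def)

text \<open>Both sides are additive in \<open>f\<close> and in \<open>g\<close>, so two monomials
  suffice. Linearity moves sums and coefficients of the inner result through the outer
  operator.\<close>

lemma act_mult:
  assumes "\<And>w. linear_op (F w)" and "\<And>v w \<xi>. F (v + w) \<xi> = F v (F w \<xi>)"
  shows "act F (f * g) \<xi> = act F f (act F g \<xi>)"
proof (induction f rule: free_alg_add_induct)
  case (single v c)
  show ?case
    by (induction g rule: free_alg_add_induct)
      (simp_all add: mult_single act_single act_add assms ring_distribs
        linear_op_add[OF linear_op_act] linear_op_add linear_op_cmult mult_ac)
qed (simp add: act_add ring_distribs)

lemma act_mult_rev:
  assumes "\<And>w. linear_op (F w)" and "\<And>v w \<xi>. F (v + w) \<xi> = F w (F v \<xi>)"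
  shows "act F (f * g) \<xi> = act F g (act F f \<xi>)"
proof (induction g rule: free_alg_add_induct)
  case (single v c)
  show ?case
    by (induction f rule: free_alg_add_induct)
      (simp_all add: mult_single act_single act_add assms ring_distribs
        linear_op_add[OF linear_op_act] linear_op_add linear_op_cmult mult_ac)
qed (simp add: act_add ring_distribs)

section \<open>The quotient ring and its cosets\<close>

lemma free_ring_simps [simp]:
  "carrier free_ring = UNIV" "x \<oplus>\<^bsub>free_ring\<^esub> y = x + y" "x \<otimes>\<^bsub>free_ring\<^esub> y = x * y"
  "\<one>\<^bsub>free_ring\<^esub> = 1" "\<zero>\<^bsub>free_ring\<^esub> = 0"
  by (simp_all add: ring_of_type_algebra_def)

lemma ring_free_ring: "ring free_ring"
proof (rule ringI)
  show "abelian_group free_ring"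
  proof (rule abelian_groupI)
    fix x :: free_alg
    show "\<exists>y\<in>carrier free_ring. y \<oplus>\<^bsub>free_ring\<^esub> x = \<zero>\<^bsub>free_ring\<^esub>"
      by (intro bexI[of _ "- x"]) simp_all
  qed (simp_all add: add_ac)
  show "monoid free_ring"
    by (rule monoidI) (simp_all add: mult_ac mult.assoc)
qed (simp_all add: ring_distribs)

lemma free_ring_uminus [simp]: "\<ominus>\<^bsub>free_ring\<^esub> x = - x"
proof -
  interpret ring free_ring by (rule ring_free_ring)
  show ?thesis using minus_equality[of "- x" x] by simp
qed

lemma ideal_C_ideal: "ideal (C_ideal hbar) free_ring"
  unfolding C_ideal_def by (rule ring.genideal_ideal[OF ring_free_ring]) simp

lemma ring_C_alg: "ring (C_alg hbar)"
  unfolding C_alg_def by (rule ideal.quotient_is_ring[OF ideal_C_ideal])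

lemma C_class_hom: "C_class hbar \<in> ring_hom free_ring (C_alg hbar)"
  using ideal.rcos_ring_hom[OF ideal_C_ideal] by (simp add: C_class_def[abs_def] C_alg_def)

lemma C_class_simps:
  "C_class hbar f \<in> carrier (C_alg hbar)"
  "C_class hbar f \<oplus>\<^bsub>C_alg hbar\<^esub> C_class hbar g = C_class hbar (f + g)"
  "C_class hbar f \<otimes>\<^bsub>C_alg hbar\<^esub> C_class hbar g = C_class hbar (f * g)"
  "\<one>\<^bsub>C_alg hbar\<^esub> = C_class hbar 1"
  using ring_hom_closed[OF C_class_hom] ring_hom_add[OF C_class_hom]
    ring_hom_mult[OF C_class_hom] ring_hom_one[OF C_class_hom] by simp_all

lemma mem_C_class: "g \<in> C_class hbar f \<longleftrightarrow> g - f \<in> C_ideal hbar"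
  by (auto simp: C_class_def a_r_coset_def' algebra_simps intro!: bexI[of _ "g - f"])

lemma self_in_C_class: "f \<in> C_class hbar f"
  using additive_subgroup.zero_closed[OF ideal.axioms(1)[OF ideal_C_ideal]]
  by (simp add: mem_C_class)

lemma C_alg_cases:
  assumes "a \<in> carrier (C_alg hbar)"
  obtains f where "a = C_class hbar f"
  using assms by (auto simp: C_alg_def FactRing_def A_RCOSETS_def' C_class_def)

lemma act_scal: "F 0 = id \<Longrightarrow> act F (scal c) \<xi> = (\<lambda>p. c * \<xi> p)"
  by (simp add: scal_def act_single)

lemma act_fvar: "act F (fvar g) = F (GWord [g])"
  by (rule ext) (simp add: fvar_def act_single)

lemma act_one: "F 0 = id \<Longrightarrow> act F 1 \<xi> = \<xi>"
  using act_scal[of F 1 \<xi>] by (simp add: scal_def)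

lemma act_diff: "act F (f - g) \<xi> = (\<lambda>p. act F f \<xi> p - act F g \<xi> p)"
  using act_add[of F "f - g" g \<xi>] by (simp add: fun_eq_iff)

section \<open>Actions of the quotient algebra\<close>

text \<open>Collects what left and right actions share. The disjunction in
  \<open>T_mult_cases\<close> lets kernel, closure and adjoints be treated once for homomorphisms
  and antihomomorphisms.\<close>

locale C_action =
  fixes hbar :: real and T :: "free_alg \<Rightarrow> (real \<times> int \<Rightarrow> complex) \<Rightarrow> real \<times> int \<Rightarrow> complex"
  assumes T_add: "T (f + g) \<xi> = (\<lambda>p. T f \<xi> p + T g \<xi> p)"
    and T_scal: "T (scal c) \<xi> = (\<lambda>p. c * \<xi> p)"
    and linear_T: "linear_op (T f)"
    and T_mult_cases: "(\<forall>f g \<xi>. T (f * g) \<xi> = T f (T g \<xi>)) \<or> (\<forall>f g \<xi>. T (f * g) \<xi> = T g (T f \<xi>))"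
    and T_rels: "f \<in> C_rels hbar \<Longrightarrow> T f \<xi> = (\<lambda>p. 0)"
    and T_fvar_closed: "\<xi> \<in> C0inf \<Longrightarrow> T (fvar v) \<xi> \<in> C0inf"
    and T_fvar_adjoint: "C0inf_inner (T (fvar v) \<xi>) \<eta> = C0inf_inner \<xi> (T (fvar (gen_star v)) \<eta>)"
begin

lemma T_zero: "T 0 \<xi> = (\<lambda>p. 0)"
  using T_scal[of 0 \<xi>] by (simp add: scal_def)

lemma T_uminus: "T (- f) \<xi> = (\<lambda>p. - T f \<xi> p)"
proof
  fix p
  have "T (- f) \<xi> p + T f \<xi> p = 0"
    using fun_cong[OF T_add[of "- f" f \<xi>], of p] by (simp add: T_zero)
  then show "T (- f) \<xi> p = - T f \<xi> p"
    by (simp only: eq_neg_iff_add_eq_0)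
qed

lemma T_diff: "T (f - g) \<xi> = (\<lambda>p. T f \<xi> p - T g \<xi> p)"
  using T_add[of f "- g" \<xi>] by (simp add: T_uminus)

text \<open>A product acts by composition in one order or the other. If either factor acts as zero,
  so does the composite, because the outer operator is linear; hence the kernel is
  two-sided.\<close>

lemma ideal_kernel: "ideal {f. \<forall>\<xi>. T f \<xi> = (\<lambda>p. 0)} free_ring"
proof -
  let ?K = "{f. \<forall>\<xi>. T f \<xi> = (\<lambda>p. 0)}"
  interpret ring free_ring by (rule ring_free_ring)
  show ?thesis
  proof (rule idealI)
    show "subgroup ?K (add_monoid free_ring)"
    proof (rule add.subgroupI)
      show "?K \<noteq> {}" using T_zero by blast
    qed (simp_all add: T_add T_uminus flip: a_inv_def)
  qed (use T_mult_cases in \<open>auto simp: ring_free_ring linear_op_zero[OF linear_T]\<close>)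
qed

lemma T_C_ideal: "f \<in> C_ideal hbar \<Longrightarrow> T f \<xi> = (\<lambda>p. 0)"
  using ring.genideal_minimal[OF ring_free_ring ideal_kernel, of "C_rels hbar"] T_rels
  by (auto simp: C_ideal_def)

lemma T_closed: "\<xi> \<in> C0inf \<Longrightarrow> T f \<xi> \<in> C0inf"
proof (induction f arbitrary: \<xi> rule: free_alg_induct)
  case (mult f g)
  then show ?case using T_mult_cases by auto
qed (simp_all add: T_scal T_add T_fvar_closed C0inf_cmult C0inf_add)

text \<open>The identity passes to products because both the star and the passage to adjoints
  reverse the order. \<open>T_closed\<close> keeps the intermediate functions in
  \<open>C0inf\<close>, where the induction hypotheses apply.\<close>

lemma T_adjoint:
  assumes "\<xi> \<in> C0inf" "\<eta> \<in> C0inf"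
  shows "C0inf_inner (T f \<xi>) \<eta> = C0inf_inner \<xi> (T (free_star f) \<eta>)"
  using assms
proof (induction f arbitrary: \<xi> \<eta> rule: free_alg_induct)
  case (scal c)
  have "free_star (scal c) = scal (cnj c)"
    by (simp add: scal_def gword_star_def zero_gword_def)
  then show ?case by (simp only: T_scal) (rule C0inf_inner_mult, simp)
next
  case (var g)
  have "free_star (fvar g) = fvar (gen_star g)"
    by (simp add: fvar_def gword_star_def)
  then show ?case by (simp add: T_fvar_adjoint)
next
  case (add f g)
  then show ?case
    by (simp add: T_add free_star_add C0inf_inner_add_left C0inf_inner_add_right T_closed)
next
  case (mult f g)
  then show ?case
    using T_mult_cases by (auto simp: free_star_mult T_closed)
qed

text \<open>A coset acts through a chosen representative; by \<open>T_cong_class\<close> the choice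
  is immaterial.\<close>

definition class_act :: "free_alg set \<Rightarrow> (real \<times> int \<Rightarrow> complex) \<Rightarrow> real \<times> int \<Rightarrow> complex" where
  "class_act a = T (SOME f. f \<in> a)"

lemma T_cong_class: "g \<in> C_class hbar f \<Longrightarrow> T g = T f"
  using T_C_ideal[of "g - f"] by (simp add: mem_C_class T_diff fun_eq_iff)

lemma class_act_C_class: "class_act (C_class hbar f) = T f"
  unfolding class_act_def by (rule T_cong_class) (rule someI, rule self_in_C_class)

text \<open>Every element of \<^term>\<open>C_star a\<close> is the star of a representative of \<open>a\<close>, so it is irrelevant
  here that \<^term>\<open>C_star a\<close> is again a coset.\<close>

lemma class_act_adjoint:
  assumes "a \<in> carrier (C_alg hbar)" "\<xi> \<in> C0inf" "\<eta> \<in> C0inf"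
  shows "C0inf_inner (class_act a \<xi>) \<eta> = C0inf_inner \<xi> (class_act (C_star a) \<eta>)"
proof -
  obtain f where f: "a = C_class hbar f" using assms(1) by (rule C_alg_cases)
  have "free_star f \<in> C_star a"
    unfolding f C_star_def by (rule imageI) (rule self_in_C_class)
  then have "(SOME h. h \<in> C_star a) \<in> C_star a" by (rule someI)
  then obtain g where g: "g \<in> a" "(SOME h. h \<in> C_star a) = free_star g"
    unfolding C_star_def by blast
  with T_cong_class have "T g = T f" by (simp add: f)
  then have "class_act a = T g" by (simp add: f class_act_C_class)
  then show ?thesis
    using T_adjoint[OF assms(2,3), of g] by (simp add: class_act_def g(2))
qed

lemma C_left_module_class_act:
  assumes "\<And>f g \<xi>. T (f * g) \<xi> = T f (T g \<xi>)"
  shows "C_left_module hbar class_act"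
  unfolding C_left_module_def
proof (intro conjI allI ballI)
  show "left_module (C_alg hbar) C0inf_group class_act"
    \<comment> \<open>This yields the unit law, as \<open>scal 1\<close> is the unit of the free
      algebra.\<close>
    using T_scal[of 1]
    by (intro left_module.intro left_module_axioms.intro ring_C_alg abelian_group_C0inf)
      (auto elim!: C_alg_cases
        simp: class_act_C_class C_class_simps C0inf_group_def T_closed T_add assms
          linear_op_add[OF linear_T] scal_def)
qed (simp add: class_act_C_class T_scal)

lemma C_right_module_class_act:
  assumes "\<And>f g \<xi>. T (f * g) \<xi> = T g (T f \<xi>)"
  shows "C_right_module hbar (\<lambda>\<xi> a. class_act a \<xi>)"
  unfolding C_right_module_def
proof (intro conjI allI ballI)
  show "right_module (C_alg hbar) C0inf_group (\<lambda>\<xi> a. class_act a \<xi>)"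
    using T_scal[of 1]
    by (intro right_module.intro right_module_axioms.intro ring_C_alg abelian_group_C0inf)
      (auto elim!: C_alg_cases
        simp: class_act_C_class C_class_simps C0inf_group_def T_closed T_add assms
          linear_op_add[OF linear_T] scal_def)
qed (simp add: class_act_C_class T_scal)

end

section \<open>Uniqueness of a module structure with given generators\<close>

text \<open>Agreement spreads from scalars and generators to sums and products. Scalars are covered
  by the second clause of \<open>C_left_module\<close>; for products \<xi> must vary, as the first
  factor acts on the image under the second.\<close>

lemma C_left_module_unique:
  assumes "C_left_module hbar lact" "C_left_module hbar lact'"
    and gen: "\<And>g \<xi>. \<xi> \<in> C0inf \<Longrightarrow> lact' (C_gen hbar g) \<xi> = lact (C_gen hbar g) \<xi>"
    and "a \<in> carrier (C_alg hbar)" "\<xi> \<in> C0inf"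
  shows "lact' a \<xi> = lact a \<xi>"
proof -
  interpret L: left_module "C_alg hbar" C0inf_group lact
    using assms(1) by (simp add: C_left_module_def)
  interpret L': left_module "C_alg hbar" C0inf_group lact'
    using assms(2) by (simp add: C_left_module_def)
  have carrier: "carrier C0inf_group = C0inf"
    by (simp add: C0inf_group_def)
  have "lact' (C_class hbar f) \<xi> = lact (C_class hbar f) \<xi>" for f
    using assms(5)
  proof (induction f arbitrary: \<xi> rule: free_alg_induct)
    case (scal c)
    then show ?case using assms(1,2) by (simp add: C_left_module_def)
  next
    case (var g)
    then show ?case by (rule gen)
  next
    case (add f g)
    then show ?case
      using L.lact_add_left[of "C_class hbar f" "C_class hbar g" \<xi>]
        L'.lact_add_left[of "C_class hbar f" "C_class hbar g" \<xi>]
      by (simp add: C_class_simps carrier)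
  next
    case (mult f g)
    then show ?case
      using L.lact_assoc[of "C_class hbar f" "C_class hbar g" \<xi>]
        L'.lact_assoc[of "C_class hbar f" "C_class hbar g" \<xi>]
        L.lact_closed[of "C_class hbar g" \<xi>]
      by (simp add: C_class_simps carrier)
  qed
  with assms(4) show ?thesis by (auto elim: C_alg_cases)
qed

lemma C_right_module_unique:
  assumes "C_right_module hbar ract" "C_right_module hbar ract'"
    and gen: "\<And>g \<xi>. \<xi> \<in> C0inf \<Longrightarrow> ract' \<xi> (C_gen hbar g) = ract \<xi> (C_gen hbar g)"
    and "a \<in> carrier (C_alg hbar)" "\<xi> \<in> C0inf"
  shows "ract' \<xi> a = ract \<xi> a"
proof -
  interpret R: right_module "C_alg hbar" C0inf_group ract
    using assms(1) by (simp add: C_right_module_def)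
  interpret R': right_module "C_alg hbar" C0inf_group ract'
    using assms(2) by (simp add: C_right_module_def)
  have carrier: "carrier C0inf_group = C0inf"
    by (simp add: C0inf_group_def)
  have "ract' \<xi> (C_class hbar f) = ract \<xi> (C_class hbar f)" for f
    using assms(5)
  proof (induction f arbitrary: \<xi> rule: free_alg_induct)
    case (scal c)
    then show ?case using assms(1,2) by (simp add: C_right_module_def)
  next
    case (var g)
    then show ?case by (rule gen)
  next
    case (add f g)
    then show ?case
      using R.ract_add_right[of \<xi> "C_class hbar f" "C_class hbar g"]
        R'.ract_add_right[of \<xi> "C_class hbar f" "C_class hbar g"]
      by (simp add: C_class_simps carrier)
  next
    case (mult f g)
    then show ?case
      using R.ract_assoc[of \<xi> "C_class hbar f" "C_class hbar g"]
        R'.ract_assoc[of \<xi> "C_class hbar f" "C_class hbar g"]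
        R.ract_closed[of \<xi> "C_class hbar f"]
      by (simp add: C_class_simps carrier)
  qed
  with assms(4) show ?thesis by (auto elim: C_alg_cases)
qed

section \<open>Translation and multiplication operators\<close>

text \<open>Left and right actions use the same operators; they differ in the order of composition
  and in the sign of the condition on the parameters.\<close>

fun gen_op :: "real \<Rightarrow> real \<Rightarrow> real \<Rightarrow> int \<Rightarrow> gen \<Rightarrow> (real \<times> int \<Rightarrow> complex) \<Rightarrow> real \<times> int \<Rightarrow> complex" where
  "gen_op l0 l1 e r gen_U \<xi> = (\<lambda>p. of_real (l0 * fst p + l1 * of_int (snd p)) * \<xi> p)"
| "gen_op l0 l1 e r gen_R \<xi> = (\<lambda>p. of_real (exp (l0 * fst p + l1 * of_int (snd p))) * \<xi> p)"
| "gen_op l0 l1 e r gen_Rinv \<xi> = (\<lambda>p. of_real (exp (- l0 * fst p - l1 * of_int (snd p))) * \<xi> p)"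
| "gen_op l0 l1 e r gen_W \<xi> = (\<lambda>p. \<xi> (fst p - e, snd p - r))"
| "gen_op l0 l1 e r gen_Winv \<xi> = (\<lambda>p. \<xi> (fst p + e, snd p + r))"

lemma linear_gen_op: "linear_op (gen_op l0 l1 e r g)"
  by (cases g) (simp_all add: linear_op_def ring_distribs mult.left_commute)

lemma gen_op_closed:
  assumes "\<xi> \<in> C0inf" shows "gen_op l0 l1 e r g \<xi> \<in> C0inf"
proof (cases g)
  case gen_Rinv
  then show ?thesis
    using smooth_exp[of "- l0" "- (l1 * of_int k)" for k] by (auto intro!: C0inf_mult assms)
next
  case gen_W
  then show ?thesis using C0inf_shift[OF assms, of "- e" "- r"] by simp
\<comment> \<open>The casts stay unexpanded so that the multipliers match \<open>smooth_exp\<close>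
  and \<open>smooth_affine\<close>.\<close>
qed (auto intro!: C0inf_mult C0inf_shift assms smooth_exp smooth_affine simp del: of_real_add of_real_mult)

lemma gen_op_adjoint:
  "C0inf_inner (gen_op l0 l1 e r g \<xi>) \<eta> = C0inf_inner \<xi> (gen_op l0 l1 e r (gen_star g) \<eta>)"
proof (cases g)
  case gen_W
  then show ?thesis using C0inf_inner_shift[of \<xi> "- e" "- r" \<eta>] by simp
qed (auto intro!: C0inf_inner_mult C0inf_inner_shift)

text \<open>With \<open>foldr\<close> the last letter of a word acts first, as in a left action;
  with \<open>fold\<close> in \<open>right_act\<close> the first letter does.\<close>

abbreviation left_act where
  "left_act l0 l1 e r \<equiv> act (\<lambda>w. foldr (gen_op l0 l1 e r) (letters w))"

abbreviation right_act where
  "right_act l0 l1 e r \<equiv> act (\<lambda>w. fold (gen_op l0 l1 e r) (letters w))"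

lemma left_act_mult: "left_act l0 l1 e r (f * g) \<xi> = left_act l0 l1 e r f (left_act l0 l1 e r g \<xi>)"
  by (rule act_mult) (simp_all add: linear_op_foldr linear_gen_op plus_gword_def)

lemma right_act_mult: "right_act l0 l1 e r (f * g) \<xi> = right_act l0 l1 e r g (right_act l0 l1 e r f \<xi>)"
  by (rule act_mult_rev) (simp_all add: linear_op_fold linear_gen_op plus_gword_def)

text \<open>Translating by \<open>(e, r)\<close> after multiplying by \<open>l0 * x + l1 * k\<close>
  replaces this factor by itself minus \<open>l0 * e + l1 * r\<close>, that is, plus
  \<open>hbar\<close>. This is the relation for \<open>W * U\<close>; its exponential gives the one
  for \<open>W * R\<close>.\<close>

lemma C_action_left:
  assumes "l0 * e + l1 * of_int r = - hbar"
  shows "C_action hbar (left_act l0 l1 e r)"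
proof
  have hbar: "hbar = - (l0 * e + l1 * of_int r)" using assms by simp
  have "\<forall>f\<in>C_rels hbar. left_act l0 l1 e r f \<xi> = (\<lambda>p. 0)" for \<xi>
    unfolding C_rels_def Let_def hbar
    \<comment> \<open>Products of exponentials are merged by adding exponents, after which the
      relations are settled by real arithmetic.\<close>
    by (simp add: act_diff act_add left_act_mult act_fvar act_scal act_one zero_gword_def
        fun_eq_iff flip: exp_add of_real_add of_real_diff of_real_mult) (simp add: algebra_simps)
  then show "left_act l0 l1 e r f \<xi> = (\<lambda>p. 0)" if "f \<in> C_rels hbar" for f \<xi>
    using that by blast
qed (auto simp: act_add act_scal zero_gword_def linear_op_act linear_op_foldr linear_gen_op
    left_act_mult act_fvar gen_op_closed gen_op_adjoint)

text \<open>Here \<open>W * U\<close> translates first and multiplies afterwards, which reverses the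
  sign of the commutator and so of the condition on the parameters.\<close>

lemma C_action_right:
  assumes "l0 * e + l1 * of_int r = hbar"
  shows "C_action hbar (right_act l0 l1 e r)"
proof
  have "\<forall>f\<in>C_rels hbar. right_act l0 l1 e r f \<xi> = (\<lambda>p. 0)" for \<xi>
    unfolding C_rels_def Let_def assms[symmetric]
    by (simp add: act_diff act_add right_act_mult act_fvar act_scal act_one zero_gword_def
        fun_eq_iff flip: exp_add of_real_add of_real_diff of_real_mult) (simp add: algebra_simps)
  then show "right_act l0 l1 e r f \<xi> = (\<lambda>p. 0)" if "f \<in> C_rels hbar" for f \<xi>
    using that by blast
qed (auto simp: act_add act_scal zero_gword_def linear_op_act linear_op_fold linear_gen_op
    right_act_mult act_fvar gen_op_closed gen_op_adjoint)

theorem proposition5p1: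
  fixes hbar l0 l1 eps m0 m1 eps' :: real and r r' :: int
  shows "(l0 * eps + l1 * of_int r = - hbar \<longrightarrow>
    (\<exists>lact. C_left_module hbar lact \<and>
      (\<forall>\<xi>\<in>C0inf. \<forall>x k.
         lact (C_gen hbar gen_W) \<xi> (x, k) = \<xi> (x - eps, k - r) \<and>
         lact (C_gen hbar gen_Winv) \<xi> (x, k) = \<xi> (x + eps, k + r) \<and>
         lact (C_gen hbar gen_R) \<xi> (x, k) = of_real (exp (l0 * x + l1 * of_int k)) * \<xi> (x, k) \<and>
         lact (C_gen hbar gen_Rinv) \<xi> (x, k) = of_real (exp (- l0 * x - l1 * of_int k)) * \<xi> (x, k) \<and>
         lact (C_gen hbar gen_U) \<xi> (x, k) = of_real (l0 * x + l1 * of_int k) * \<xi> (x, k)) \<and>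
      (\<forall>lact'. C_left_module hbar lact' \<and>
         (\<forall>g. \<forall>\<xi>\<in>C0inf. lact' (C_gen hbar g) \<xi> = lact (C_gen hbar g) \<xi>) \<longrightarrow>
         (\<forall>a\<in>carrier (C_alg hbar). \<forall>\<xi>\<in>C0inf. lact' a \<xi> = lact a \<xi>)) \<and>
      (\<forall>a\<in>carrier (C_alg hbar). \<forall>\<xi>\<in>C0inf. \<forall>\<eta>\<in>C0inf.
         C0inf_inner (lact a \<xi>) \<eta> = C0inf_inner \<xi> (lact (C_star a) \<eta>)))) \<and>
   (m0 * eps' + m1 * of_int r' = hbar \<longrightarrow>
    (\<exists>ract. C_right_module hbar ract \<and>
      (\<forall>\<xi>\<in>C0inf. \<forall>x k.
         ract \<xi> (C_gen hbar gen_W) (x, k) = \<xi> (x - eps', k - r') \<and>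
         ract \<xi> (C_gen hbar gen_Winv) (x, k) = \<xi> (x + eps', k + r') \<and>
         ract \<xi> (C_gen hbar gen_R) (x, k) = of_real (exp (m0 * x + m1 * of_int k)) * \<xi> (x, k) \<and>
         ract \<xi> (C_gen hbar gen_Rinv) (x, k) = of_real (exp (- m0 * x - m1 * of_int k)) * \<xi> (x, k) \<and>
         ract \<xi> (C_gen hbar gen_U) (x, k) = of_real (m0 * x + m1 * of_int k) * \<xi> (x, k)) \<and>
      (\<forall>ract'. C_right_module hbar ract' \<and>
         (\<forall>g. \<forall>\<xi>\<in>C0inf. ract' \<xi> (C_gen hbar g) = ract \<xi> (C_gen hbar g)) \<longrightarrow>
         (\<forall>a\<in>carrier (C_alg hbar). \<forall>\<xi>\<in>C0inf. ract' \<xi> a = ract \<xi> a)) \<and>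
      (\<forall>a\<in>carrier (C_alg hbar). \<forall>\<xi>\<in>C0inf. \<forall>\<eta>\<in>C0inf.
         C0inf_inner (ract \<xi> a) \<eta> = C0inf_inner \<xi> (ract \<eta> (C_star a)))))"
proof (intro conjI impI, goal_cases)
  case 1
  then interpret C_action hbar "left_act l0 l1 eps r" by (rule C_action_left)
  have mod: "C_left_module hbar class_act"
    by (rule C_left_module_class_act) (rule left_act_mult)
  show ?case
    by (intro exI[of _ class_act] conjI ballI allI impI mod class_act_adjoint)
      (auto simp: class_act_C_class act_fvar intro: C_left_module_unique[OF mod])
next
  case 2
  then interpret C_action hbar "right_act m0 m1 eps' r'" by (rule C_action_right)
  \<comment> \<open>The reversed composition in \<open>right_act\<close> becomes the associativity
    law of a right module once the arguments are swapped.\<close>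
  have mod: "C_right_module hbar (\<lambda>\<xi> a. class_act a \<xi>)"
    by (rule C_right_module_class_act) (rule right_act_mult)
  show ?case
    by (intro exI[of _ "\<lambda>\<xi> a. class_act a \<xi>"] conjI ballI allI impI mod class_act_adjoint)
      (auto simp: class_act_C_class act_fvar intro: C_right_module_unique[OF mod])
qed

end
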